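(* Let $\boldsymbol x_1,\boldsymbol x_2,\boldsymbol x_3,\boldsymbol x_4\in\Gamma$ be four non-coplanar points and assume $\inf_{0\le t\le T_0+T_1}\|\boldsymbol f(t)\times\boldsymbol\nu(\boldsymbol x_j)\|_\infty>0$ for $j=1,2,3,4$. Then the orbit function $\boldsymbol a(t)$, $t\in(0,T_0)$, is uniquely determined by the data $\boldsymbol\nu(\boldsymbol x_j)\times\boldsymbol H(\boldsymbol x_j,t)$, $j=1,2,3,4$, $t\in(0,T_0+T_1)$. That is, if $\boldsymbol a$ and $\tilde{\boldsymbol a}$ are admissible orbits whose generated magnetic fields $\boldsymbol H$ and $\widetilde{\boldsymbol H}$ (with the same $\boldsymbol f$) satisfy $\boldsymbol\nu(\boldsymbol x_j)\times\boldsymbol H(\boldsymbol x_j,t)=\boldsymbol\nu(\boldsymbol x_j)\times\widetilde{\boldsymbol H}(\boldsymbol x_j,t)$ for all $j=1,2,3,4$ and all $t\in(0,T_0+T_1)$, then $\boldsymbol a(t)=\tilde{\boldsymbol a}(t)$ for all $t\in(0,T_0)$.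
   Context: Setting. Let $c>0$ be the wave speed, $0<c_0<c$, $a_0>0$, $T_0>0$, and let $D\subset\mathbb R^3$ be a bounded domain. Let $\Omega\subset\mathbb R^3$ be a bounded smooth domain with $D\subset\subset\Omega$, boundary $\Gamma=\partial\Omega$ and outward unit normal $\boldsymbol\nu$ on $\Gamma$. Let $\boldsymbol f:[0,\infty)\to\mathbb R^3$ be a $C^1$ function. An orbit $\boldsymbol a:[0,\infty)\to\mathbb R^3$ is called admissible if it is of class $C^2[0,\infty)$ and satisfies: (1) $\boldsymbol a(t)\in D$ for all $t\ge0$; (2) $|\boldsymbol a'(t)|\le c_0$ for all $t>0$; (3) $|\boldsymbol a''(t)|\le a_0$ for all $t>0$. The magnetic field $\boldsymbol H$ generated by an admissible orbit $\boldsymbol a$ is the solution of $\frac1{c^2}\partial_t^2\boldsymbol H-\Delta\boldsymbol H=\delta(\boldsymbol x-\boldsymbol a(t))\boldsymbol f(t)$ in $\mathbb R^3\times(0,\infty)$ with $\boldsymbol H=\partial_t\boldsymbol H=0$ for $t\le0$. For $\boldsymbol x\in\Gamma$ it is given explicitly as follows: with $g(t)=t+|\boldsymbol x-\boldsymbol a(t)|/c$, a strictly increasing function on $[0,\infty)$ with inverse $g^{-1}$, $$\boldsymbol H(\boldsymbol x,t)=\frac{\boldsymbol f(g^{-1}(t))}{4\pi\,|\boldsymbol x-\boldsymbol a(g^{-1}(t))|\;g'(g^{-1}(t))}\quad\text{for } t\ge |\boldsymbol x-\boldsymbol a(0)|/c,\qquad \boldsymbol H(\boldsymbol x,t)=0\quad\text{for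 } t<|\boldsymbol x-\boldsymbol a(0)|/c.$$ Let $T_1=\sup_{\boldsymbol z\in\Gamma,\,\boldsymbol y\in D}|\boldsymbol z-\boldsymbol y|/c$. For $\boldsymbol y\in\mathbb R^3$, $\|\boldsymbol y\|_\infty=\max_{1\le i\le3}|y_i|$. *)

theory Defs
  imports "HOL-Analysis.Analysis"
begin

definition open_domain :: "'a::euclidean_space set \<Rightarrow> bool" where
  "open_domain S \<longleftrightarrow> open S \<and> connected S \<and> S \<noteq> {}"

primrec Ck_on :: "nat \<Rightarrow> 'a::euclidean_space set \<Rightarrow> ('a \<Rightarrow> real) \<Rightarrow> bool" where
  "Ck_on 0 U f \<longleftrightarrow> continuous_on U f"
| "Ck_on (Suc k) U f \<longleftrightarrow>
     (\<exists>G. (\<forall>x\<in>U. (f has_derivative (\<lambda>h. G x \<bullet> h)) (at x)) \<and>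
          (\<forall>b\<in>Basis. Ck_on k U (\<lambda>x. G x \<bullet> b)))"

definition smooth_on :: "'a::euclidean_space set \<Rightarrow> ('a \<Rightarrow> real) \<Rightarrow> bool" where
  "smooth_on U f \<longleftrightarrow> (\<forall>k. Ck_on k U f)"

text \<open>Near the point \<open>p\<close>, the set \<open>S\<close> is the sublevel set \<open>\<rho> < 0\<close> of a smooth function whose
  gradient \<open>G\<close> has no zero.\<close>

definition local_defining_function ::
  "'a::euclidean_space set \<Rightarrow> 'a \<Rightarrow> 'a set \<Rightarrow> ('a \<Rightarrow> real) \<Rightarrow> ('a \<Rightarrow> 'a) \<Rightarrow> bool" where
  "local_defining_function S p U \<rho> G \<longleftrightarrow>
     open U \<and> p \<in> U \<and> smooth_on U \<rho> \<and>
     (\<forall>x\<in>U. (\<rho> has_derivative (\<lambda>h. G x \<bullet> h)) (at x) \<and> G x \<noteq> 0) \<and>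
     S \<inter> U = {x \<in> U. \<rho> x < 0} \<and> frontier S \<inter> U = {x \<in> U. \<rho> x = 0}"

definition smooth_domain :: "'a::euclidean_space set \<Rightarrow> bool" where
  "smooth_domain S \<longleftrightarrow>
     open_domain S \<and> (\<forall>p\<in>frontier S. \<exists>U \<rho> G. local_defining_function S p U \<rho> G)"

text \<open>The vector \<open>n\<close> below does not depend on the choice of \<open>\<rho>\<close>.\<close>

definition outward_unit_normal :: "'a::euclidean_space set \<Rightarrow> 'a \<Rightarrow> 'a \<Rightarrow> bool" where
  "outward_unit_normal S p n \<longleftrightarrow>
     p \<in> frontier S \<and>
     (\<exists>U \<rho> G. local_defining_function S p U \<rho> G \<and> n = G p /\<^sub>R norm (G p))"

text \<open>All derivatives on the half-line \<open>{0..}\<close> are one-sided at \<open>0\<close>; values at negative times play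
  no role.\<close>

definition C1_halfline :: "(real \<Rightarrow> real^3) \<Rightarrow> bool" where
  "C1_halfline f \<longleftrightarrow>
     (\<exists>f'. (\<forall>t\<ge>0. (f has_vector_derivative f' t) (at t within {0..})) \<and> continuous_on {0..} f')"

definition admissible_orbit ::
  "real \<Rightarrow> real \<Rightarrow> (real^3) set \<Rightarrow> (real \<Rightarrow> real^3) \<Rightarrow> bool" where
  "admissible_orbit c\<^sub>0 a\<^sub>0 D a \<longleftrightarrow>
     (\<exists>a' a''.
        (\<forall>t\<ge>0. (a has_vector_derivative a' t) (at t within {0..})) \<and>
        (\<forall>t\<ge>0. (a' has_vector_derivative a'' t) (at t within {0..})) \<and>
        continuous_on {0..} a'' \<and>
        (\<forall>t\<ge>0. a t \<in> D) \<and>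
        (\<forall>t>0. norm (a' t) \<le> c\<^sub>0) \<and>
        (\<forall>t>0. norm (a'' t) \<le> a\<^sub>0))"

text \<open>A signal emitted at time \<open>s\<close> from \<open>a s\<close> reaches \<open>x\<close> at time \<open>arrival_time c a x s\<close>.\<close>

definition arrival_time :: "real \<Rightarrow> (real \<Rightarrow> real^3) \<Rightarrow> real^3 \<Rightarrow> real \<Rightarrow> real" where
  "arrival_time c a x s = s + norm (x - a s) / c"

text \<open>The retarded (Lienard-Wiechert) representation, at points \<open>x\<close> off the orbit, of the causal
  solution of \<open>H\<^sub>t\<^sub>t / c\<^sup>2 - \<Delta> H = \<delta>(x - a(t)) f(t)\<close>.\<close>

definition magnetic_field ::
  "real \<Rightarrow> (real \<Rightarrow> real^3) \<Rightarrow> (real \<Rightarrow> real^3) \<Rightarrow> real^3 \<Rightarrow> real \<Rightarrow> real^3" where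
  "magnetic_field c f a x t =
     (if t < norm (x - a 0) / c then 0
      else let g = arrival_time c a x; s = inv_into {0..} g t
           in f s /\<^sub>R (4 * pi * norm (x - a s) * vector_derivative g (at s within {0..})))"

definition max_travel_time :: "real \<Rightarrow> (real^3) set \<Rightarrow> (real^3) set \<Rightarrow> real" where
  "max_travel_time c \<Gamma> D = (SUP (z, y) \<in> \<Gamma> \<times> D. norm (z - y) / c)"

end

theory Submission
  imports Defs
begin

text \<open>
  Each receiver \<open>x\<^sub>j\<close> determines the distance to the source as a function of time, and four distances
  to non-coplanar points determine a point.

  Fix one receiver \<open>x\<close> with normal \<open>n\<close>. For an orbit \<open>a\<close> let \<open>h(t)\<close> be the emission time of the
  signal that arrives at time \<open>t\<close>, the inverse of the arrival time \<open>g(s) = s + |x - a(s)| / c\<close>. The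
  inverse exists and is differentiable because \<open>g' \<ge> 1 - c\<^sub>0/c > 0\<close>. Since \<open>|x - a(h(t))| = c (t - h(t))\<close>
  and \<open>1 / g'(h(t)) = h'(t)\<close>, the norm of the data is
  \<open>|n \<times> H(x,t)| = M(h(t)) h'(t) / (4 \<pi> c (t - h(t)))\<close> with \<open>M(s) = |n \<times> f(s)|\<close>; the orbit
  enters only through \<open>h\<close>.

  Let \<open>k\<close> be the emission time of a second orbit with the same data. As \<open>M\<close> does not vanish, the
  onset of the data is the first arrival time, so both \<open>h\<close> and \<open>k\<close> start from \<open>0\<close> at the same
  time \<open>\<tau>\<close> (\<open>first_arrival_determined\<close>). From then on
  \<open>M(h) h' / (t - h) = M(k) k' / (t - k)\<close>, where \<open>M\<close> is Lipschitz and bounded away from zero, \<open>t - h\<close> and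
  \<open>t - k\<close> are bounded away from zero because \<open>x\<close> has positive distance from \<open>D\<close>, and \<open>k'\<close> is bounded.
  Hence \<open>|h' - k'| \<le> K |h - k|\<close>, and \<open>h = k\<close> by Gronwall's argument
  (\<open>lipschitz_ode_unique\<close>). This gives \<open>|x - a(s)| = |x - b(s)|\<close> whenever the signal emitted at
  \<open>s\<close> arrives within the observation window (\<open>distance_determined\<close>), which holds for all
  \<open>s < T\<^sub>0\<close> since no signal travels longer than \<open>T\<^sub>1\<close>.
\<close>

section \<open>Uniqueness for the emission-time equation\<close>

text \<open>Gronwall's argument: \<open>u\<^sup>2 exp (-2Kt)\<close> is nonincreasing.\<close>

lemma zero_of_derivative_bound:
  fixes u u' :: "real \<Rightarrow> real"
  assumes cont: "continuous_on {a..b} u" and "a \<le> b" and "u a = 0"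
    and der: "\<And>t. a < t \<Longrightarrow> t < b \<Longrightarrow> (u has_real_derivative u' t) (at t)"
    and bound: "\<And>t. a < t \<Longrightarrow> t < b \<Longrightarrow> \<bar>u' t\<bar> \<le> K * \<bar>u t\<bar>"
  shows "u b = 0"
proof -
  let ?w = "\<lambda>t. (u t)\<^sup>2 * exp (- 2 * K * t)"
  have "?w b \<le> ?w a"
  proof (rule DERIV_nonpos_imp_decreasing_open [OF \<open>a \<le> b\<close>])
    fix t assume t: "a < t" "t < b"
    have "u t * u' t \<le> \<bar>u t\<bar> * \<bar>u' t\<bar>"
      by (metis abs_ge_self abs_mult)
    also have "\<dots> \<le> \<bar>u t\<bar> * (K * \<bar>u t\<bar>)"
      using bound[OF t] by (intro mult_left_mono) auto
    also have "\<dots> = K * (u t)\<^sup>2"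
      by (simp add: power2_eq_square)
    finally have "2 * (u t * u' t - K * (u t)\<^sup>2) \<le> 0" by simp
    then have "2 * (u t * u' t - K * (u t)\<^sup>2) * exp (- 2 * K * t) \<le> 0"
      by (rule mult_nonpos_nonneg) simp
    moreover have "(?w has_real_derivative 2 * (u t * u' t - K * (u t)\<^sup>2) * exp (- 2 * K * t)) (at t)"
      by (auto intro!: derivative_eq_intros der[OF t] simp: algebra_simps power2_eq_square)
    ultimately show "\<exists>y. (?w has_real_derivative y) (at t) \<and> y \<le> 0"
      by blast
  qed (intro continuous_intros cont)
  then show ?thesis
    using \<open>u a = 0\<close> by (auto simp: mult_le_0_iff)
qed

text \<open>Two functions \<open>h\<close>, \<open>k\<close> that satisfy \<open>M(h) h' / (t - h) = M(k) k' / (t - k)\<close> and agree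
  at \<open>\<tau>\<close> agree up to time \<open>T\<close>: solving for \<open>h'\<close> bounds \<open>|h' - k'|\<close> by a multiple of
  \<open>|k'| |h - k|\<close>.\<close>

lemma lipschitz_ode_unique:
  fixes h k h' k' M :: "real \<Rightarrow> real"
  assumes "0 < m" "0 < \<delta>" "0 \<le> L" "0 \<le> B"
    and conth: "continuous_on {\<tau>..} h" and contk: "continuous_on {\<tau>..} k"
    and derh: "\<And>t. \<tau> < t \<Longrightarrow> (h has_real_derivative h' t) (at t)"
    and derk: "\<And>t. \<tau> < t \<Longrightarrow> (k has_real_derivative k' t) (at t)"
    and h0: "\<And>t. \<tau> \<le> t \<Longrightarrow> 0 \<le> h t" and k0: "\<And>t. \<tau> \<le> t \<Longrightarrow> 0 \<le> k t"
    and hd: "\<And>t. \<tau> \<le> t \<Longrightarrow> \<delta> \<le> t - h t" and kd: "\<And>t. \<tau> \<le> t \<Longrightarrow> \<delta> \<le> t - k t"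
    and k'B: "\<And>t. \<tau> < t \<Longrightarrow> \<bar>k' t\<bar> \<le> B"
    and Mm: "\<And>s. 0 \<le> s \<Longrightarrow> s \<le> T \<Longrightarrow> m \<le> M s"
    and lip: "\<And>s s'. s \<in> {0..T} \<Longrightarrow> s' \<in> {0..T} \<Longrightarrow> \<bar>M s - M s'\<bar> \<le> L * \<bar>s - s'\<bar>"
    and eq: "\<And>t. \<tau> < t \<Longrightarrow> t < T \<Longrightarrow> M (h t) * h' t / (t - h t) = M (k t) * k' t / (t - k t)"
    and init: "h \<tau> = k \<tau>"
    and t: "\<tau> \<le> t" "t < T"
  shows "h t = k t"
proof -
  let ?K = "B * (L * T / (m * \<delta>) + 1 / \<delta>)"
  have "h t - k t = 0"
  proof (rule zero_of_derivative_bound [where u = "\<lambda>t. h t - k t" and u' = "\<lambda>t. h' t - k' t" and K = ?K])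
    fix r assume r: "\<tau> < r" "r < t"
    show "((\<lambda>t. h t - k t) has_real_derivative h' r - k' r) (at r)"
      by (intro derivative_intros derh derk r)
    define p q where "p = h r" and "q = k r"
    have p: "0 \<le> p" "\<delta> \<le> r - p" and q: "0 \<le> q" "\<delta> \<le> r - q"
      using h0[of r] k0[of r] hd[of r] kd[of r] r by (auto simp: p_def q_def)
    have pT: "p \<in> {0..T}" and qT: "q \<in> {0..T}"
      using p q r t \<open>0 < \<delta>\<close> by auto
    have Mp: "m \<le> M p"
      using Mm pT by auto
    have nz: "M p \<noteq> 0" "r - q \<noteq> 0" "r - p \<noteq> 0"
      using Mp p q \<open>0 < m\<close> \<open>0 < \<delta>\<close> by auto
    have "M p * h' r / (r - p) = M q * k' r / (r - q)"
      using eq[of r] r t by (simp add: p_def q_def)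
    \<comment> \<open>Write \<open>h'\<close> as \<open>k'\<close> times \<open>1\<close> plus two terms of the order of \<open>|p - q|\<close>.\<close>
    then have h': "h' r = k' r * (M q * (r - p) / (M p * (r - q)))"
      using nz by (simp add: field_simps)
    have e1: "(M q - M p) * (r - p) / (M p * (r - q)) =
        M q * (r - p) / (M p * (r - q)) - (r - p) / (r - q)"
      using nz by (simp add: left_diff_distrib diff_divide_distrib)
    have e2: "(q - p) / (r - q) = (r - p) / (r - q) - 1"
      using nz by (simp add: field_simps)
    have *: "h' r - k' r =
        k' r * ((M q - M p) * (r - p) / (M p * (r - q)) + (q - p) / (r - q))"
      unfolding e1 e2 h' by (simp add: right_diff_distrib)
    have 1: "\<bar>(M q - M p) * (r - p) / (M p * (r - q))\<bar> \<le> (L * \<bar>p - q\<bar>) * T / (m * \<delta>)"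
    proof -
      have "\<bar>(M q - M p) * (r - p) / (M p * (r - q))\<bar> = \<bar>M q - M p\<bar> * (r - p) / (M p * (r - q))"
        using Mp p q \<open>0 < m\<close> \<open>0 < \<delta>\<close> by (simp add: abs_mult)
      also have "\<dots> \<le> (L * \<bar>p - q\<bar>) * T / (m * \<delta>)"
        using Mp p q \<open>0 < m\<close> \<open>0 < \<delta>\<close> lip[OF qT pT] r t \<open>0 \<le> L\<close>
        by (intro frac_le mult_mono mult_pos_pos) (auto simp: abs_minus_commute)
      finally show ?thesis .
    qed
    have 2: "\<bar>(q - p) / (r - q)\<bar> \<le> \<bar>p - q\<bar> / \<delta>"
      using q \<open>0 < \<delta>\<close> by (auto simp: abs_minus_commute intro!: frac_le)
    have "\<bar>h' r - k' r\<bar> \<le> B * ((L * \<bar>p - q\<bar>) * T / (m * \<delta>) + \<bar>p - q\<bar> / \<delta>)"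
      unfolding * abs_mult
      using 1 2 k'B[OF r(1)] \<open>0 \<le> B\<close>
      by (intro mult_mono order_trans[OF abs_triangle_ineq] add_mono) auto
    also have "\<dots> = ?K * \<bar>p - q\<bar>"
      by (simp add: algebra_simps)
    finally show "\<bar>h' r - k' r\<bar> \<le> ?K * \<bar>h r - k r\<bar>"
      by (simp add: p_def q_def)
  next
    show "continuous_on {\<tau>..t} (\<lambda>t. h t - k t)"
      by (intro continuous_intros continuous_on_subset[OF conth] continuous_on_subset[OF contk]) auto
  qed (use init t in auto)
  then show ?thesis by simp
qed

section \<open>Arrival and emission times\<close>

text \<open>On \<open>{0..}\<close>, a function whose derivative is bounded below by \<open>\<kappa> > 0\<close> maps onto
  \<open>{g 0..}\<close> and has a Lipschitz, differentiable inverse.\<close>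

lemma expanding_inverse:
  fixes g g' :: "real \<Rightarrow> real" and \<kappa> :: real
  defines "h \<equiv> inv_into {0..} g"
  assumes "0 < \<kappa>"
    and der: "\<And>s. 0 \<le> s \<Longrightarrow> (g has_real_derivative g' s) (at s within {0..})"
    and lower: "\<And>s. 0 \<le> s \<Longrightarrow> \<kappa> \<le> g' s"
  shows "\<And>s. 0 \<le> s \<Longrightarrow> h (g s) = s"
    and "\<And>t. g 0 \<le> t \<Longrightarrow> 0 \<le> h t \<and> g (h t) = t"
    and "continuous_on {g 0..} h"
    and "\<And>t. g 0 < t \<Longrightarrow> (h has_real_derivative inverse (g' (h t))) (at t)"
proof -
  have contg: "continuous_on {0..} g"
    unfolding continuous_on_eq_continuous_within
    using der by (meson DERIV_continuous atLeast_iff)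
  have exp: "\<kappa> * (s' - s) \<le> g s' - g s" if "0 \<le> s" "s \<le> s'" for s s'
  proof -
    have "g s - \<kappa> * s \<le> g s' - \<kappa> * s'"
    proof (rule DERIV_nonneg_imp_increasing_open [OF that(2)])
      fix r assume r: "s < r" "r < s'"
      have "at r within {0..} = at r"
        using r that by (intro at_within_interior) auto
      then have "((\<lambda>s. g s - \<kappa> * s) has_real_derivative g' r - \<kappa>) (at r)"
        using der[of r] r that by (auto intro!: derivative_eq_intros)
      then show "\<exists>y. ((\<lambda>s. g s - \<kappa> * s) has_real_derivative y) (at r) \<and> 0 \<le> y"
        using lower[of r] r that by (intro exI[of _ "g' r - \<kappa>"]) auto
    next
      show "continuous_on {s..s'} (\<lambda>s. g s - \<kappa> * s)"
        using that by (intro continuous_intros continuous_on_subset[OF contg]) auto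
    qed
    then show ?thesis by (simp add: algebra_simps)
  qed
  have inj: "inj_on g {0..}"
  proof (rule linorder_inj_onI)
    fix s s' :: real assume "s < s'" "s \<in> {0..}" "s' \<in> {0..}"
    moreover from this have "0 < \<kappa> * (s' - s)" using \<open>0 < \<kappa>\<close> by simp
    ultimately show "g s \<noteq> g s'" using exp[of s s'] by auto
  qed auto
  show left: "h (g s) = s" if "0 \<le> s" for s
    unfolding h_def using inj that by (intro inv_into_f_f) auto
  show right: "0 \<le> h t \<and> g (h t) = t" if "g 0 \<le> t" for t
  proof -
    \<comment> \<open>Growth at rate \<open>\<kappa>\<close> makes \<open>g\<close> reach the level \<open>t\<close> by time \<open>S\<close>.\<close>
    define S where "S = (t - g 0) / \<kappa>"
    have "0 \<le> S" "t \<le> g S"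
      using that \<open>0 < \<kappa>\<close> exp[of 0 S] by (auto simp: S_def)
    then have "\<exists>s. 0 \<le> s \<and> s \<le> S \<and> g s = t"
      using that by (intro IVT' continuous_on_subset[OF contg]) auto
    then show ?thesis using left by auto
  qed
  have lip: "\<bar>h t' - h t\<bar> \<le> \<bar>t' - t\<bar> / \<kappa>" if "g 0 \<le> t" "g 0 \<le> t'" for t t'
    using exp[of "h t" "h t'"] exp[of "h t'" "h t"] right[OF that(1)] right[OF that(2)] \<open>0 < \<kappa>\<close>
    by (cases "h t \<le> h t'") (auto simp: field_simps)
  show conth: "continuous_on {g 0..} h"
  proof (rule lipschitz_on_continuous_on)
    show "(1 / \<kappa>)-lipschitz_on {g 0..} h"
      using lip \<open>0 < \<kappa>\<close> by (intro lipschitz_onI) (auto simp: dist_real_def)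
  qed
  show "(h has_real_derivative inverse (g' (h t))) (at t)" if "g 0 < t" for t
  proof (rule DERIV_inverse_function [where a = "g 0" and b = "t + 1"])
    have "h t \<noteq> 0" "0 \<le> h t" using right[of t] that by auto
    moreover from this have "at (h t) within {0..} = at (h t)"
      by (intro at_within_interior) auto
    ultimately show "(g has_real_derivative g' (h t)) (at (h t))"
      using der[of "h t"] by simp
    show "g' (h t) \<noteq> 0" using lower[of "h t"] \<open>0 \<le> h t\<close> \<open>0 < \<kappa>\<close> by auto
    show "isCont h t"
      using continuous_on_interior[OF conth] that by simp
  qed (use right that in auto)
qed

lemma arrival_time_derivative:
  assumes "0 < c" "c\<^sub>0 < c" and adm: "admissible_orbit c\<^sub>0 a\<^sub>0 D a" and "x \<notin> D" and "0 \<le> s"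
  defines "g' \<equiv> vector_derivative (arrival_time c a x) (at s within {0..})"
  shows "(arrival_time c a x has_real_derivative g') (at s within {0..})"
    and "1 - c\<^sub>0 / c \<le> g'"
proof -
  obtain a' a'' where a: "\<And>t. 0 \<le> t \<Longrightarrow> (a has_vector_derivative a' t) (at t within {0..})"
    and a2: "\<And>t. 0 \<le> t \<Longrightarrow> (a' has_vector_derivative a'' t) (at t within {0..})"
    and aD: "\<And>t. 0 \<le> t \<Longrightarrow> a t \<in> D" and speed: "\<And>t. 0 < t \<Longrightarrow> norm (a' t) \<le> c\<^sub>0"
    using adm unfolding admissible_orbit_def by blast
  have "continuous_on {0..} a'"
    using a2 by (auto simp: continuous_on_eq_continuous_within intro: has_vector_derivative_continuous)
  \<comment> \<open>The speed bound is assumed for positive times only and extends to time \<open>0\<close> by continuity.\<close>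
  then have "continuous_on (closure {0<..}) (\<lambda>t. norm (a' t))"
    by (auto intro: continuous_on_norm)
  then have speed: "norm (a' s) \<le> c\<^sub>0"
    by (rule continuous_le_on_closure) (use speed \<open>0 \<le> s\<close> in auto)
  have ne: "x - a s \<noteq> 0" using aD[OF \<open>0 \<le> s\<close>] \<open>x \<notin> D\<close> by auto
  define n where "n = sgn (x - a s)"
  have "norm n = 1" using ne by (simp add: n_def norm_sgn)
  have "((\<lambda>s. x - a s) has_derivative (\<lambda>h. h *\<^sub>R - a' s)) (at s within {0..})"
    using a[OF \<open>0 \<le> s\<close>] by (auto simp: has_vector_derivative_def intro!: derivative_eq_intros)
  from has_derivative_compose[OF this has_derivative_norm[OF ne]]
  have "((\<lambda>s. norm (x - a s)) has_derivative (\<lambda>h. n \<bullet> (h *\<^sub>R - a' s))) (at s within {0..})"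
    by (simp add: n_def inner_commute)
  moreover have "(\<lambda>h. n \<bullet> (h *\<^sub>R - a' s)) = (*) (- (n \<bullet> a' s))"
    by (auto simp: fun_eq_iff)
  ultimately have "((\<lambda>s. norm (x - a s)) has_real_derivative - (n \<bullet> a' s)) (at s within {0..})"
    by (simp add: has_field_derivative_def)
  then have der: "(arrival_time c a x has_real_derivative 1 - (n \<bullet> a' s) / c) (at s within {0..})"
    unfolding arrival_time_def[abs_def] using \<open>0 < c\<close>
    by (auto intro!: derivative_eq_intros)
  have "at s within {0..} \<noteq> bot"
    using at_le[of "{s<..}" "{0..}" s] trivial_limit_at_right_real[of s] \<open>0 \<le> s\<close>
    by (force simp: bot_unique subset_iff)
  then have g': "g' = 1 - (n \<bullet> a' s) / c"
    unfolding g'_def using der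
    by (intro vector_derivative_within) (simp_all add: has_real_derivative_iff_has_vector_derivative)
  show "(arrival_time c a x has_real_derivative g') (at s within {0..})"
    using der g' by simp
  have "n \<bullet> a' s \<le> c\<^sub>0"
    using norm_cauchy_schwarz[of n "a' s"] speed \<open>norm n = 1\<close> by simp
  then show "1 - c\<^sub>0 / c \<le> g'"
    using \<open>0 < c\<close> by (simp add: g' divide_right_mono)
qed

text \<open>The emission time \<open>h\<close> at the receiver \<open>x\<close>, from the first arrival time \<open>\<tau>\<close> on, and the
  field expressed through \<open>h\<close> and \<open>h'\<close>. At \<open>t = \<tau>\<close> the number \<open>h' t\<close> stands for the one-sided
  derivative.\<close>

lemma emission_time:
  fixes x :: "real^3"
  assumes "0 < c" "c\<^sub>0 < c" "admissible_orbit c\<^sub>0 a\<^sub>0 D a" "x \<notin> D"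
  defines "\<tau> \<equiv> norm (x - a 0) / c"
  obtains h h' where
    "continuous_on {\<tau>..} h" "h \<tau> = 0"
    "\<And>t. \<tau> < t \<Longrightarrow> (h has_real_derivative h' t) (at t)"
    "\<And>t. \<tau> \<le> t \<Longrightarrow> 0 < h' t \<and> h' t \<le> 1 / (1 - c\<^sub>0 / c)"
    "\<And>t. \<tau> \<le> t \<Longrightarrow> 0 \<le> h t \<and> norm (x - a (h t)) = c * (t - h t)"
    "\<And>t. \<tau> \<le> t \<Longrightarrow> magnetic_field c f a x t = (h' t / (4 * pi * c * (t - h t))) *\<^sub>R f (h t)"
    "\<And>s. 0 \<le> s \<Longrightarrow> \<tau> \<le> arrival_time c a x s \<and> h (arrival_time c a x s) = s"
proof -
  let ?g = "arrival_time c a x"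
  define g' where "g' s = vector_derivative ?g (at s within {0..})" for s
  define \<kappa> where "\<kappa> = 1 - c\<^sub>0 / c"
  define h where "h = inv_into {0..} ?g"
  have "0 < \<kappa>" using assms by (simp add: \<kappa>_def)
  have der: "(?g has_real_derivative g' s) (at s within {0..})" and low: "\<kappa> \<le> g' s" if "0 \<le> s" for s
    using arrival_time_derivative[OF assms(1-4) that] by (auto simp: g'_def \<kappa>_def)
  note inv = expanding_inverse[of \<kappa> ?g g', OF \<open>0 < \<kappa>\<close> der low, folded h_def]
  have g0: "?g 0 = \<tau>" by (simp add: arrival_time_def \<tau>_def)
  have h: "0 \<le> h t \<and> ?g (h t) = t" if "\<tau> \<le> t" for t
    using inv(2)[of t] that g0 by simp
  have dist: "norm (x - a (h t)) = c * (t - h t)" if "\<tau> \<le> t" for t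
    using h[OF that] \<open>0 < c\<close> unfolding arrival_time_def by (auto simp: field_simps)
  show ?thesis
  proof (rule that[of h "\<lambda>t. inverse (g' (h t))"])
    show "continuous_on {\<tau>..} h" using inv(3) g0 by simp
    show "h \<tau> = 0" using inv(1)[of 0] g0 by simp
    show "(h has_real_derivative inverse (g' (h t))) (at t)" if "\<tau> < t" for t
      using inv(4)[of t] that g0 by simp
    show "0 < inverse (g' (h t)) \<and> inverse (g' (h t)) \<le> 1 / (1 - c\<^sub>0 / c)" if "\<tau> \<le> t" for t
      using low[of "h t"] h[OF that] \<open>0 < \<kappa>\<close> unfolding \<kappa>_def[symmetric]
      by (auto simp: inverse_eq_divide intro!: divide_left_mono)
    show "0 \<le> h t \<and> norm (x - a (h t)) = c * (t - h t)" if "\<tau> \<le> t" for t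
      using h[OF that] dist[OF that] by simp
    show "magnetic_field c f a x t = (inverse (g' (h t)) / (4 * pi * c * (t - h t))) *\<^sub>R f (h t)"
      if "\<tau> \<le> t" for t
    proof -
      have "magnetic_field c f a x t = f (h t) /\<^sub>R (4 * pi * norm (x - a (h t)) * g' (h t))"
        using that unfolding magnetic_field_def Let_def h_def g'_def \<tau>_def by simp
      moreover have "inverse (4 * pi * norm (x - a (h t)) * g' (h t)) =
          inverse (g' (h t)) / (4 * pi * c * (t - h t))"
        unfolding dist[OF that] by (simp add: divide_inverse mult_ac)
      ultimately show ?thesis by (simp only:)
    qed
    show "\<tau> \<le> ?g s \<and> h (?g s) = s" if "0 \<le> s" for s
    proof -
      have ge: "\<tau> \<le> ?g s"
      proof -
        have "?g 0 \<le> ?g s"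
        proof (rule DERIV_nonneg_imp_increasing_open [OF that])
          fix r assume r: "0 < r" "r < s"
          then have "at r within {0..} = at r"
            by (intro at_within_interior) auto
          then show "\<exists>y. (?g has_real_derivative y) (at r) \<and> 0 \<le> y"
            using der[of r] low[of r] r \<open>0 < \<kappa>\<close> by (intro exI[of _ "g' r"]) auto
        next
          show "continuous_on {0..s} ?g"
            unfolding continuous_on_eq_continuous_within
            using DERIV_continuous[OF DERIV_subset[OF der]] by auto
        qed
        then show ?thesis using g0 by simp
      qed
      then show ?thesis using inv(1)[of s] that by simp
    qed
  qed
qed

section \<open>What a single receiver determines\<close>

lemma C1_halfline_lipschitz:
  assumes "C1_halfline f"
  obtains L where "0 \<le> L"
    "\<And>s s'. s \<in> {0..T} \<Longrightarrow> s' \<in> {0..T} \<Longrightarrow> norm (f s - f s') \<le> L * \<bar>s - s'\<bar>"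
proof -
  obtain f' where f: "\<And>t. 0 \<le> t \<Longrightarrow> (f has_vector_derivative f' t) (at t within {0..})"
    and cont: "continuous_on {0..} f'"
    using assms unfolding C1_halfline_def by blast
  have "compact (f' ` {0..T})"
    by (intro compact_continuous_image continuous_on_subset[OF cont]) auto
  then obtain L where L: "0 < L" "\<And>s. s \<in> {0..T} \<Longrightarrow> norm (f' s) \<le> L"
    by (metis bounded_pos compact_imp_bounded imageI)
  show ?thesis
  proof (rule that[of L])
    fix s s' assume s: "s \<in> {0..T}" "s' \<in> {0..T}"
    have "norm (f s - f s') \<le> L * norm (s - s')"
    proof (rule differentiable_bound[of "{0..T}" f "\<lambda>t h. h *\<^sub>R f' t"])
      show "(f has_derivative (\<lambda>h. h *\<^sub>R f' t)) (at t within {0..T})" if "t \<in> {0..T}" for t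
        using f[of t] that unfolding has_vector_derivative_def
        by (auto intro: has_derivative_subset)
      show "onorm (\<lambda>h. h *\<^sub>R f' t) \<le> L" if "t \<in> {0..T}" for t
      proof (rule onorm_le)
        show "norm (h *\<^sub>R f' t) \<le> L * norm h" for h
          using mult_right_mono[OF L(2)[OF that], of "\<bar>h\<bar>"] by (simp add: mult.commute)
      qed
    qed (use s in auto)
    then show "norm (f s - f s') \<le> L * \<bar>s - s'\<bar>" by simp
  qed (use L in auto)
qed

lemma norm_cross3_le: "norm (cross3 v w) \<le> norm v * norm w"
proof (rule power2_le_imp_le)
  show "(norm (cross3 v w))\<^sup>2 \<le> (norm v * norm w)\<^sup>2"
    using norm_cross_dot[of v w] by (metis le_add_same_cancel1 zero_le_power2)
qed simp

text \<open>The field of \<open>a\<close> has a nonzero component orthogonal to \<open>n\<close> at its first arrival time, so the field of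
  \<open>b\<close> cannot still vanish then.\<close>

lemma first_arrival_determined:
  fixes x n :: "real^3"
  assumes "0 < c" "c\<^sub>0 < c" "admissible_orbit c\<^sub>0 a\<^sub>0 D a" "x \<notin> D"
    and nz: "cross3 n (f 0) \<noteq> 0"
    and "norm (x - a 0) / c < T"
    and "0 < norm (x - a 0) / c"
    and data: "\<forall>t\<in>{0<..<T}. cross3 n (magnetic_field c f a x t) = cross3 n (magnetic_field c f b x t)"
  shows "norm (x - b 0) / c \<le> norm (x - a 0) / c"
proof (rule ccontr)
  define \<tau> where "\<tau> = norm (x - a 0) / c"
  assume "\<not> ?thesis"
  then have "magnetic_field c f b x \<tau> = 0"
    by (simp add: magnetic_field_def \<tau>_def)
  then have 0: "cross3 n (magnetic_field c f a x \<tau>) = 0"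
    using data assms(6,7) by (simp add: \<tau>_def)
  obtain h h' where h: "h \<tau> = 0" "0 < h' \<tau>"
    "magnetic_field c f a x \<tau> = (h' \<tau> / (4 * pi * c * (\<tau> - h \<tau>))) *\<^sub>R f (h \<tau>)"
    using emission_time[OF assms(1-4), of f] unfolding \<tau>_def by (metis order_refl)
  have "(h' \<tau> / (4 * pi * c * \<tau>)) *\<^sub>R cross3 n (f 0) = 0"
    using 0 h by (simp add: cross_mult_right)
  then show False
    using nz h(2) assms(1,7) by (simp add: \<tau>_def)
qed

lemma distance_determined:
  fixes x n :: "real^3"
  assumes "0 < c" "c\<^sub>0 < c"
    and adm: "admissible_orbit c\<^sub>0 a\<^sub>0 D a" "admissible_orbit c\<^sub>0 a\<^sub>0 D b"
    and x: "x \<notin> closure D"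
    and f: "C1_halfline f"
    and "0 < m" and m: "\<And>t. t \<in> {0..T} \<Longrightarrow> m \<le> norm (cross3 n (f t))"
    and aT: "norm (x - a 0) / c < T" and bT: "norm (x - b 0) / c < T"
    and data: "\<forall>t\<in>{0<..<T}. cross3 n (magnetic_field c f a x t) = cross3 n (magnetic_field c f b x t)"
    and s: "0 \<le> s" "arrival_time c a x s < T"
  shows "norm (x - a s) = norm (x - b s)"
proof -
  have xD: "x \<notin> D" using x closure_subset by blast
  obtain d where "0 < d" and d: "\<And>y. y \<in> D \<Longrightarrow> d \<le> norm (x - y)"
  proof -
    have "open (- closure D)" by (rule open_Compl[OF closed_closure])
    then obtain e where "0 < e" "ball x e \<subseteq> - closure D"
      using x by (meson ComplI openE)
    then have "ball x e \<inter> D = {}" using closure_subset by blast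
    then show ?thesis
      using \<open>0 < e\<close> by (intro that[of e]) (auto simp: dist_norm not_less disjoint_iff)
  qed
  have aD: "a t \<in> D" and bD: "b t \<in> D" if "0 \<le> t" for t
    using adm that unfolding admissible_orbit_def by blast+
  have pos: "0 < norm (x - a 0) / c" "0 < norm (x - b 0) / c"
    using d[OF aD[of 0]] d[OF bD[of 0]] \<open>0 < d\<close> \<open>0 < c\<close>
    by (auto intro!: divide_pos_pos)
  have "0 \<le> T" using pos aT by linarith
  have nz: "cross3 n (f 0) \<noteq> 0" using m[of 0] \<open>0 < m\<close> \<open>0 \<le> T\<close> by auto
  define \<tau> where "\<tau> = norm (x - a 0) / c"
  have \<tau>b: "\<tau> = norm (x - b 0) / c"
    unfolding \<tau>_def
  proof (rule antisym)
    have "\<forall>t\<in>{0<..<T}. cross3 n (magnetic_field c f b x t) = cross3 n (magnetic_field c f a x t)"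
      using data by simp
    then show "norm (x - a 0) / c \<le> norm (x - b 0) / c"
      by (rule first_arrival_determined[where f = f and n = n, OF assms(1,2) adm(2) xD nz bT pos(2)])
    show "norm (x - b 0) / c \<le> norm (x - a 0) / c"
      by (rule first_arrival_determined[where f = f and n = n,
            OF assms(1,2) adm(1) xD nz aT pos(1) data])
  qed
  obtain h h' where h: "continuous_on {\<tau>..} h" "h \<tau> = 0"
    "\<And>t. \<tau> < t \<Longrightarrow> (h has_real_derivative h' t) (at t)"
    "\<And>t. \<tau> \<le> t \<Longrightarrow> 0 < h' t \<and> h' t \<le> 1 / (1 - c\<^sub>0 / c)"
    "\<And>t. \<tau> \<le> t \<Longrightarrow> 0 \<le> h t \<and> norm (x - a (h t)) = c * (t - h t)"
    "\<And>t. \<tau> \<le> t \<Longrightarrow> magnetic_field c f a x t = (h' t / (4 * pi * c * (t - h t))) *\<^sub>R f (h t)"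
    "\<And>s. 0 \<le> s \<Longrightarrow> \<tau> \<le> arrival_time c a x s \<and> h (arrival_time c a x s) = s"
    by (rule emission_time[OF assms(1,2) adm(1) xD, of f, folded \<tau>_def]) (rule that; assumption)
  obtain k k' where k: "continuous_on {\<tau>..} k" "k \<tau> = 0"
    "\<And>t. \<tau> < t \<Longrightarrow> (k has_real_derivative k' t) (at t)"
    "\<And>t. \<tau> \<le> t \<Longrightarrow> 0 < k' t \<and> k' t \<le> 1 / (1 - c\<^sub>0 / c)"
    "\<And>t. \<tau> \<le> t \<Longrightarrow> 0 \<le> k t \<and> norm (x - b (k t)) = c * (t - k t)"
    "\<And>t. \<tau> \<le> t \<Longrightarrow> magnetic_field c f b x t = (k' t / (4 * pi * c * (t - k t))) *\<^sub>R f (k t)"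
    "\<And>s. 0 \<le> s \<Longrightarrow> \<tau> \<le> arrival_time c b x s \<and> k (arrival_time c b x s) = s"
    by (rule emission_time[OF assms(1,2) adm(2) xD, of f, folded \<tau>b]) (rule that; assumption)
  obtain L where L: "0 \<le> L"
    "\<And>s s'. s \<in> {0..T} \<Longrightarrow> s' \<in> {0..T} \<Longrightarrow> norm (f s - f s') \<le> L * \<bar>s - s'\<bar>"
    using C1_halfline_lipschitz[OF f] by blast
  have hd: "d / c \<le> t - h t" if "\<tau> \<le> t" for t
    using h(5)[OF that] d[OF aD, of "h t"] \<open>0 < c\<close> by (simp add: field_simps)
  have kd: "d / c \<le> t - k t" if "\<tau> \<le> t" for t
    using k(5)[OF that] d[OF bD, of "k t"] \<open>0 < c\<close> by (simp add: field_simps)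
  define t where "t = arrival_time c a x s"
  have t: "\<tau> \<le> t" "t < T" "h t = s" using h(7)[OF s(1)] s(2) by (auto simp: t_def)
  have "h t = k t"
  proof (rule lipschitz_ode_unique[where m = m and \<delta> = "d / c" and L = "norm n * L" and
        B = "1 / (1 - c\<^sub>0 / c)" and \<tau> = \<tau> and T = T and M = "\<lambda>s. norm (cross3 n (f s))" and
        h = h and k = k and h' = h' and k' = k'])
    show "0 \<le> 1 / (1 - c\<^sub>0 / c)" using assms(1,2) by simp
    show "\<bar>k' t\<bar> \<le> 1 / (1 - c\<^sub>0 / c)" if "\<tau> < t" for t
      using k(4)[of t] that by auto
    show "\<bar>norm (cross3 n (f s)) - norm (cross3 n (f s'))\<bar> \<le> norm n * L * \<bar>s - s'\<bar>"
      if "s \<in> {0..T}" "s' \<in> {0..T}" for s s'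
    proof -
      have "\<bar>norm (cross3 n (f s)) - norm (cross3 n (f s'))\<bar> \<le> norm (cross3 n (f s - f s'))"
        by (metis Cross3.right_diff_distrib norm_triangle_ineq3)
      also have "\<dots> \<le> norm n * norm (f s - f s')" by (rule norm_cross3_le)
      also have "\<dots> \<le> norm n * (L * \<bar>s - s'\<bar>)" by (intro mult_left_mono L that) auto
      finally show ?thesis by (simp add: mult.assoc)
    qed
    show "norm (cross3 n (f (h t))) * h' t / (t - h t) = norm (cross3 n (f (k t))) * k' t / (t - k t)"
      if "\<tau> < t" "t < T" for t
    proof -
      have "t \<in> {0<..<T}" using that pos(1)[folded \<tau>_def] by simp
      then have "cross3 n (magnetic_field c f a x t) = cross3 n (magnetic_field c f b x t)"
        using data by blast
      then have "cross3 n ((h' t / (4 * pi * c * (t - h t))) *\<^sub>R f (h t)) =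
          cross3 n ((k' t / (4 * pi * c * (t - k t))) *\<^sub>R f (k t))"
        using h(6)[of t] k(6)[of t] that(1) by simp
      then have eq: "norm ((h' t / (4 * pi * c * (t - h t))) *\<^sub>R cross3 n (f (h t))) =
          norm ((k' t / (4 * pi * c * (t - k t))) *\<^sub>R cross3 n (f (k t)))"
        by (simp add: cross_mult_right)
      have pos: "0 < t - h t" "0 < t - k t" "0 < h' t" "0 < k' t"
        using hd[of t] kd[of t] h(4)[of t] k(4)[of t] that divide_pos_pos[OF \<open>0 < d\<close> \<open>0 < c\<close>]
        by auto
      have nf: "norm ((r / (4 * pi * c * e)) *\<^sub>R v) = norm v * r / e / (4 * pi * c)"
        if "0 < r" "0 < e" for r e and v :: "real^3"
        using that \<open>0 < c\<close> by (simp add: abs_mult mult_ac)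
      have "4 * pi * c \<noteq> 0" using \<open>0 < c\<close> by simp
      then show ?thesis
        using eq unfolding nf[OF pos(3,1)] nf[OF pos(4,2)] by (simp only: divide_cancel_right) simp
    qed
  qed (use h k hd kd m L \<open>0 < m\<close> \<open>0 < d\<close> \<open>0 < c\<close> pos t in \<open>auto simp: \<tau>_def\<close>)
  then have "k t = s" using t by simp
  then show ?thesis
    using h(5)[OF t(1)] k(5)[OF t(1)] t(3) by simp
qed

section \<open>Four non-coplanar receivers\<close>

lemma coplanar_hyperplane:
  fixes n :: "real^3"
  assumes "n \<noteq> 0"
  shows "coplanar {y. n \<bullet> y = r}"
proof -
  obtain B where B: "affine hull B = affine hull {y. n \<bullet> y = r}" "\<not> affine_dependent B"
      "of_nat (card B) = aff_dim {y. n \<bullet> y = r} + 1"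
    using aff_dim_basis_exists by metis
  then have "finite B" "card B \<le> 3"
    using aff_dim_hyperplane[OF assms, of r] by (auto simp: aff_independent_finite)
  then have "coplanar B" by (rule coplanar_small)
  then show ?thesis
    by (metis B(1) coplanar_affine_hull_coplanar)
qed

lemma equidistant_noncoplanar:
  fixes p q :: "real^3"
  assumes "\<not> coplanar S" and eq: "\<And>y. y \<in> S \<Longrightarrow> norm (y - p) = norm (y - q)"
  shows "p = q"
proof (rule ccontr)
  assume "p \<noteq> q"
  have "S \<subseteq> {y. (q - p) \<bullet> y = ((norm q)\<^sup>2 - (norm p)\<^sup>2) / 2}"
  proof
    fix y assume "y \<in> S"
    then have "(norm (y - p))\<^sup>2 = (norm (y - q))\<^sup>2" using eq by simp
    then show "y \<in> {y. (q - p) \<bullet> y = ((norm q)\<^sup>2 - (norm p)\<^sup>2) / 2}"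
      by (simp add: power2_norm_eq_inner inner_diff inner_commute algebra_simps)
  qed
  moreover have "coplanar {y. (q - p) \<bullet> y = ((norm q)\<^sup>2 - (norm p)\<^sup>2) / 2}"
    using \<open>p \<noteq> q\<close> by (intro coplanar_hyperplane) auto
  ultimately show False
    using assms(1) by (meson coplanar_subset)
qed

lemma travel_time_le_max:
  assumes "0 < c" "bounded \<Gamma>" "bounded D" "z \<in> \<Gamma>" "y \<in> D"
  shows "norm (z - y) / c \<le> max_travel_time c \<Gamma> D"
proof -
  obtain B B' where B: "\<And>z. z \<in> \<Gamma> \<Longrightarrow> norm z \<le> B" and B': "\<And>y. y \<in> D \<Longrightarrow> norm y \<le> B'"
    using assms(2,3) unfolding bounded_iff by blast
  have "norm (z - y) \<le> B + B'" if "z \<in> \<Gamma>" "y \<in> D" for z y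
    using B[OF that(1)] B'[OF that(2)] norm_triangle_ineq4[of z y] by linarith
  then have "bdd_above ((\<lambda>(z, y). norm (z - y) / c) ` (\<Gamma> \<times> D))"
    using \<open>0 < c\<close> by (intro bdd_aboveI2[of _ _ "(B + B') / c"]) (auto intro!: divide_right_mono)
  from cSUP_upper[OF _ this, of "(z, y)"] show ?thesis
    using assms by (simp add: max_travel_time_def)
qed

theorem corollary3p1:
  fixes c c\<^sub>0 a\<^sub>0 T\<^sub>0 T\<^sub>1 :: real
    and D \<Omega> \<Gamma> :: "(real^3) set"
    and \<nu> :: "real^3 \<Rightarrow> real^3"
    and f a a_tilde :: "real \<Rightarrow> real^3"
    and x :: "4 \<Rightarrow> real^3"
  assumes "0 < c" and "0 < c\<^sub>0" and "c\<^sub>0 < c" and "0 < a\<^sub>0" and "0 < T\<^sub>0"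
    and "open_domain D" and "bounded D"
    and "smooth_domain \<Omega>" and "bounded \<Omega>" and "closure D \<subseteq> \<Omega>"
    and "\<Gamma> = frontier \<Omega>" and "\<forall>z\<in>\<Gamma>. outward_unit_normal \<Omega> z (\<nu> z)"
    and "T\<^sub>1 = max_travel_time c \<Gamma> D"
    and "C1_halfline f"
    and "\<forall>j. x j \<in> \<Gamma>" and "\<not> coplanar (range x)"
    and "\<forall>j. (INF t\<in>{0..T\<^sub>0 + T\<^sub>1}. infnorm (cross3 (f t) (\<nu> (x j)))) > 0"
    and "admissible_orbit c\<^sub>0 a\<^sub>0 D a" and "admissible_orbit c\<^sub>0 a\<^sub>0 D a_tilde"
    and "\<forall>j. \<forall>t\<in>{0<..<T\<^sub>0 + T\<^sub>1}.
           cross3 (\<nu> (x j)) (magnetic_field c f a (x j) t) =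
           cross3 (\<nu> (x j)) (magnetic_field c f a_tilde (x j) t)"
  shows "\<forall>t\<in>{0<..<T\<^sub>0}. a t = a_tilde t"
proof
  fix t assume t: "t \<in> {0<..<T\<^sub>0}"
  have aD: "a s \<in> D" and bD: "a_tilde s \<in> D" if "0 \<le> s" for s
    using assms(18,19) that unfolding admissible_orbit_def by blast+
  have "bounded \<Gamma>"
    using \<open>bounded \<Omega>\<close> \<open>\<Gamma> = frontier \<Omega>\<close> by (simp add: compact_frontier_bounded compact_imp_bounded)
  have travel: "norm (x j - y) / c \<le> T\<^sub>1" if "y \<in> D" for j y
    using travel_time_le_max[OF \<open>0 < c\<close> \<open>bounded \<Gamma>\<close> \<open>bounded D\<close> _ that] assms(13,15) by simp
  have "norm (x j - a t) = norm (x j - a_tilde t)" for j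
  proof (rule distance_determined[where T = "T\<^sub>0 + T\<^sub>1" and D = D and n = "\<nu> (x j)" and a = a and
        b = a_tilde and s = t and f = f and c = c and c\<^sub>0 = c\<^sub>0 and a\<^sub>0 = a\<^sub>0])
    let ?m = "INF t\<in>{0..T\<^sub>0 + T\<^sub>1}. infnorm (cross3 (f t) (\<nu> (x j)))"
    show "0 < ?m" using assms(17) by blast
    show "?m \<le> norm (cross3 (\<nu> (x j)) (f t))" if "t \<in> {0..T\<^sub>0 + T\<^sub>1}" for t
    proof -
      have "?m \<le> infnorm (cross3 (f t) (\<nu> (x j)))"
        using that by (intro cINF_lower bdd_belowI2[of _ 0]) (auto simp: infnorm_pos_le)
      also have "\<dots> \<le> norm (cross3 (f t) (\<nu> (x j)))" by (rule infnorm_le_norm)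
      finally show ?thesis by (metis cross_skew norm_minus_cancel)
    qed
    have "open \<Omega>" using assms(8) by (simp add: smooth_domain_def open_domain_def)
    then have "\<Gamma> \<inter> \<Omega> = {}" using assms(11) by (auto simp: frontier_def interior_open)
    then show "x j \<notin> closure D" using assms(10,15) by blast
    show "norm (x j - a 0) / c < T\<^sub>0 + T\<^sub>1" "norm (x j - a_tilde 0) / c < T\<^sub>0 + T\<^sub>1"
      using travel[OF aD[of 0], of j] travel[OF bD[of 0], of j] \<open>0 < T\<^sub>0\<close> by auto
    show "arrival_time c a (x j) t < T\<^sub>0 + T\<^sub>1"
      using travel[OF aD[of t], of j] t by (simp add: arrival_time_def)
  qed (use assms t in auto)
  then show "a t = a_tilde t"
    using assms(16) by (intro equidistant_noncoplanar[of "range x"]) auto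
qed

end
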